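(* Let $f:[0,1]\to\mathbb{R}$ be a function that determines an $f$-belos for every cusp $P=(p,0)$, $p\in(0,1)$, and that is also differentiable at $0$ and at $1$; for each $p\in(0,1)$ let $\mathcal{T}=T_1T_2T_3P$ be the tangent parallelogram. Then the diagonal line $T_1T_3$ of $\mathcal{T}$ (the one opposite to the cusp $P$) is tangent to the graph of $f$ at $(p,f(p))$ for every $p\in(0,1)$ if and only if $f$ is a parabola of the form $f(x)=k(x-x^2)$ for all $x\in[0,1]$, for some constant $k$. Moreover, in this case $\mathcal{T}$ is a rectangle if and only if $k=1$.
   Context: Let $f:[0,1]\to\mathbb{R}$ be continuous on $[0,1]$, differentiable on $(0,1)$, with $f(0)=f(1)=0$ and $f(x)>0$ for $x\in(0,1)$; here $f$ is moreover assumed to be (one-sidedly) differentiable at $x=0$ and $x=1$. Given $p\in(0,1)$, define $g:[0,p]\to\mathbb{R}$ by $g(x)=p\,f(x/p)$ and $h:[p,1]\to\mathbb{R}$ by $h(x)=(1-p)\,f\left(\frac{x-p}{1-p}\right)$. It is assumed that the graphs of $g$ and $h$ are below the graph of $f$, i.e. $g\le f$ on $[0,p]$ and $h\le f$ on $[p,1]$ (here, for every $p\in(0,1)$). The $f$-belos with cusp $P=(p,0)$ is the plane figure bounded above by the graph of $f$ and below by the graphs of $g$ and $h$. Its tangent parallelogram $\mathcal{T}=T_1T_2T_3P$ has its sides on the tangent lines to the graph of $f$ at $x=0$ and $x=1$ and the tangent lines to the graphs of $g$ and $h$ at $x=p$: the side $T_1T_2$ lies on $y=f'(0)x$, the side $PT_3$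 on $y=f'(0)(x-p)$, the side $T_1P$ on $y=f'(1)(x-p)$, and the side $T_2T_3$ on $y=f'(1)(x-1)$. A line is tangent to the graph of $f$ at $(p,f(p))$ if it passes through $(p,f(p))$ with slope $f'(p)$. *)

theory Defs
  imports "HOL-Analysis.Analysis"
begin

definition lower_left :: "(real \<Rightarrow> real) \<Rightarrow> real \<Rightarrow> real \<Rightarrow> real" where
  "lower_left f p x = p * f (x / p)"

definition lower_right :: "(real \<Rightarrow> real) \<Rightarrow> real \<Rightarrow> real \<Rightarrow> real" where
  "lower_right f p x = (1 - p) * f ((x - p) / (1 - p))"

text \<open>Functions on a closed interval are total functions \<^typ>\<open>real \<Rightarrow> real\<close> of which only the
  values on the interval are used; in particular derivatives at the end points are taken within
  the interval, that is, one-sided.\<close>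

definition determines_belos :: "(real \<Rightarrow> real) \<Rightarrow> real \<Rightarrow> bool" where
  "determines_belos f p \<longleftrightarrow>
     continuous_on {0..1} f \<and> f differentiable_on {0<..<1} \<and>
     f 0 = 0 \<and> f 1 = 0 \<and> (\<forall>x\<in>{0<..<1}. 0 < f x) \<and>
     (\<forall>x\<in>{0..p}. lower_left f p x \<le> f x) \<and>
     (\<forall>x\<in>{p..1}. lower_right f p x \<le> f x)"

text \<open>The tangent line at abscissa \<open>a\<close> to the graph of \<open>u\<close>, regarded as a function on \<open>S\<close>.\<close>

definition tangent_line :: "(real \<Rightarrow> real) \<Rightarrow> real set \<Rightarrow> real \<Rightarrow> (real \<times> real) set" where
  "tangent_line u S a = {(x, y). y = u a + vector_derivative u (at a within S) * (x - a)}"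

definition meet :: "(real \<times> real) set \<Rightarrow> (real \<times> real) set \<Rightarrow> real \<times> real" where
  "meet L M = (THE q. q \<in> L \<and> q \<in> M)"

text \<open>The vertices of the tangent parallelogram other than the cusp \<open>(p, 0)\<close>. The tangent lines to
  \<open>lower_left f p\<close> and \<open>lower_right f p\<close> at \<open>p\<close> have slopes \<open>f'(1)\<close> and \<open>f'(0)\<close>, respectively.\<close>

definition T1 :: "(real \<Rightarrow> real) \<Rightarrow> real \<Rightarrow> real \<times> real" where
  "T1 f p = meet (tangent_line f {0..1} 0) (tangent_line (lower_left f p) {0..p} p)"

definition T2 :: "(real \<Rightarrow> real) \<Rightarrow> real \<Rightarrow> real \<times> real" where
  "T2 f p = meet (tangent_line f {0..1} 0) (tangent_line f {0..1} 1)"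

definition T3 :: "(real \<Rightarrow> real) \<Rightarrow> real \<Rightarrow> real \<times> real" where
  "T3 f p = meet (tangent_line (lower_right f p) {p..1} p) (tangent_line f {0..1} 1)"

definition is_parallelogram ::
    "real \<times> real \<Rightarrow> real \<times> real \<Rightarrow> real \<times> real \<Rightarrow> real \<times> real \<Rightarrow> bool" where
  "is_parallelogram A B C D \<longleftrightarrow> \<not> collinear {A, B, C} \<and> B - A = C - D"

definition is_rectangle ::
    "real \<times> real \<Rightarrow> real \<times> real \<Rightarrow> real \<times> real \<Rightarrow> real \<times> real \<Rightarrow> bool" where
  "is_rectangle A B C D \<longleftrightarrow> is_parallelogram A B C D \<and> orthogonal (B - A) (D - A)"

end

theory Submission
  imports Defs
begin

text \<open>Write \<open>a = f'(0)\<close>, \<open>b = f'(1)\<close>. The belos inequalities say that the chord slopes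
  from the end points are monotone, so \<open>b < 0 < a\<close> and the parallelogram is nondegenerate.
  Tangency of \<open>T\<^sub>1T\<^sub>3\<close> at \<open>p\<close> is a linear system for \<open>f(p)\<close> and \<open>f'(p)\<close> whose solution is
  \<open>f(p) = -ab p(1-p)/D(p)\<close>, \<open>f'(p) = -ab (1-2p)/D(p)\<close> with \<open>D(p) = (a+b)p - b\<close>.
  Differentiating the first formula and comparing with the second forces \<open>(a+b) p(1-p) = 0\<close>,
  hence \<open>b = -a\<close> and \<open>f(p) = a(p - p\<^sup>2)\<close>.\<close>

section \<open>Tangent lines as sets, and their intersections\<close>

lemma tangent_line_interval_eq:
  fixes u :: "real \<Rightarrow> real"
  assumes "(u has_real_derivative m) (at a within {l..r})" "l < r" "a \<in> {l..r}"
  shows "tangent_line u {l..r} a = {(x, y). y = u a + m * (x - a)}"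
proof -
  \<comment> \<open>On a nondegenerate interval the derivative within it is unique, even at an end
    point, so the choice made by \<open>vector_derivative\<close> is \<open>m\<close>.\<close>
  have "vector_derivative u (at a within {l..r}) = m"
    using assms vector_derivative_within_cbox[of l r a u m]
    by (simp add: has_real_derivative_iff_has_vector_derivative)
  then show ?thesis by (simp add: tangent_line_def)
qed

lemma meet_eq:
  fixes m n x0 y0 x1 y1 x :: real
  assumes "m \<noteq> n" and "y0 + m * (x - x0) = y1 + n * (x - x1)"
  shows "meet {(x, y). y = y0 + m * (x - x0)} {(x, y). y = y1 + n * (x - x1)}
           = (x, y0 + m * (x - x0))"
  unfolding meet_def
proof (rule the_equality)
  fix q :: "real \<times> real"
  assume *: "q \<in> {(x, y). y = y0 + m * (x - x0)} \<and> q \<in> {(x, y). y = y1 + n * (x - x1)}"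
  obtain s t where q: "q = (s, t)" by force
  have "(m - n) * (s - x) = 0"
    using * assms(2) q by (simp add: algebra_simps)
  then have "s = x" using assms(1) by simp
  then show "q = (x, y0 + m * (x - x0))" using * q by auto
qed (use assms in auto)

section \<open>Signs of the end slopes\<close>

lemma derivative_at_0_lower_bound:
  fixes g :: "real \<Rightarrow> real"
  assumes "(g has_real_derivative d) (at 0 within {0..1})" "g 0 = 0"
    and "\<And>x. 0 < x \<Longrightarrow> x < 1/2 \<Longrightarrow> c * x \<le> g x"
  shows "c \<le> d"
proof (rule tendsto_lowerbound)
  show "((\<lambda>x. (g x - g 0) / (x - 0)) \<longlongrightarrow> d) (at 0 within {0..1})"
    using assms(1) by (simp add: has_field_derivative_iff)
  show "\<forall>\<^sub>F x in at 0 within {0..1}. c \<le> (g x - g 0) / (x - 0)"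
    unfolding eventually_at
    by (rule exI[of _ "1/2"]) (use assms(2,3) in \<open>auto simp: field_simps dist_real_def\<close>)
  show "at 0 within {0..1::real} \<noteq> bot"
    using at_within_Icc_at_right[of 0 "1::real"] by simp
qed

text \<open>Serves the one-sided derivatives of \<open>f\<close> after an affine change of variable:
  it suffices that the inner map sends \<open>S\<close> into \<open>T\<close>.\<close>

lemma DERIV_chain_into:
  assumes "(f has_field_derivative d) (at (g x) within T)"
    and "(g has_field_derivative e) (at x within S)" "g ` S \<subseteq> T"
  shows "((\<lambda>x. f (g x)) has_field_derivative d * e) (at x within S)"
  using DERIV_image_chain[OF DERIV_subset[OF assms(1,3)] assms(2)] by (simp add: o_def)

text \<open>Positivity of \<open>f\<close> alone would only give \<open>0 \<le> a\<close>. For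
  strictness the cusp is varied with \<open>x\<close>: the cusp \<open>2 * x\<close> makes
  \<open>x\<close> the midpoint of \<open>{0..2 * x}\<close>, so the lower left arc there has height
  \<open>2 * x * f (1/2)\<close>. Being a cusp, \<open>2 * x\<close> must stay below 1, hence the
  range \<open>x < 1/2\<close>.\<close>

lemma belos_slope_0_pos:
  assumes "\<forall>p\<in>{0<..<1}. determines_belos f p"
    and "(f has_real_derivative a) (at 0 within {0..1})"
  shows "0 < a"
proof -
  have f: "f 0 = 0" "0 < f (1/2)"
    using assms(1)[rule_format, of "1/2"] by (auto simp: determines_belos_def)
  have "2 * f (1/2) * x \<le> f x" if "0 < x" "x < 1/2" for x
  proof -
    have "lower_left f (2 * x) x \<le> f x"
      using assms(1)[rule_format, of "2 * x"] that by (auto simp: determines_belos_def)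
    then show ?thesis using that by (simp add: lower_left_def mult_ac)
  qed
  with derivative_at_0_lower_bound[OF assms(2) f(1)] f(2) show ?thesis by force
qed

lemma belos_slope_1_neg:
  assumes "\<forall>p\<in>{0<..<1}. determines_belos f p"
    and "(f has_real_derivative b) (at 1 within {0..1})"
  shows "b < 0"
proof -
  have f: "f 1 = 0" "0 < f (1/2)"
    using assms(1)[rule_format, of "1/2"] by (auto simp: determines_belos_def)
  \<comment> \<open>Reflection in 1/2 moves the end point 1 to 0 and turns the slope
    \<open>b\<close> into \<open>- b\<close>.\<close>
  have im: "(\<lambda>x. 1 - x) ` {0..1} = {0..1::real}"
    by simp
  have "((\<lambda>x. f (1 - x)) has_real_derivative b * (-1)) (at 0 within {0..1})"
    by (rule DERIV_chain_into[where g = "\<lambda>x. 1 - x" and T = "{0..1}"])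
       (use assms(2) im in \<open>auto intro!: derivative_eq_intros\<close>)
  then have d: "((\<lambda>x. f (1 - x)) has_real_derivative - b) (at 0 within {0..1})" by simp
  \<comment> \<open>The cusp \<open>1 - 2 * x\<close> makes \<open>1 - x\<close> the midpoint of the
    right-hand interval.\<close>
  have "2 * f (1/2) * x \<le> f (1 - x)" if "0 < x" "x < 1/2" for x
  proof -
    have "lower_right f (1 - 2 * x) (1 - x) \<le> f (1 - x)"
      using assms(1)[rule_format, of "1 - 2 * x"] that by (auto simp: determines_belos_def)
    then show ?thesis using that by (simp add: lower_right_def mult_ac)
  qed
  with derivative_at_0_lower_bound[OF d] f show ?thesis by force
qed

section \<open>Tangents of the lower arcs and vertices of the parallelogram\<close>

lemma tangent_line_lower_left:
  assumes "(f has_real_derivative b) (at 1 within {0..1})" "f 1 = 0" "0 < p"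
  shows "tangent_line (lower_left f p) {0..p} p = {(x, y). y = 0 + b * (x - p)}"
proof -
  have im: "(\<lambda>x. x / p) ` {0..p} = {0..1}"
    using assms(3) by (simp add: image_divide_atLeastAtMost)
  have "((\<lambda>x. f (x / p)) has_real_derivative b * (1 / p)) (at p within {0..p})"
    by (rule DERIV_chain_into[where g = "\<lambda>x. x / p" and T = "{0..1}"])
       (use assms im in \<open>auto intro!: derivative_eq_intros\<close>)
  then have "((\<lambda>x. p * f (x / p)) has_real_derivative p * (b * (1 / p))) (at p within {0..p})"
    by (rule DERIV_cmult)
  \<comment> \<open>Both axes are scaled by \<open>p\<close>, so slopes are preserved; abscissa
    \<open>p\<close> corresponds to the end point 1 of \<open>f\<close>.\<close>
  then have "(lower_left f p has_real_derivative b) (at p within {0..p})"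
    using assms(3) by (simp add: lower_left_def[abs_def])
  from tangent_line_interval_eq[OF this] show ?thesis
    using assms by (simp add: lower_left_def)
qed

lemma tangent_line_lower_right:
  assumes "(f has_real_derivative a) (at 0 within {0..1})" "f 0 = 0" "p < 1"
  shows "tangent_line (lower_right f p) {p..1} p = {(x, y). y = 0 + a * (x - p)}"
proof -
  have im: "(\<lambda>x. (x - p) / (1 - p)) ` {p..1} \<subseteq> {0..1}"
    using assms(3) by auto
  have "((\<lambda>x. f ((x - p) / (1 - p))) has_real_derivative a * (1 / (1 - p))) (at p within {p..1})"
    by (rule DERIV_chain_into[where g = "\<lambda>x. (x - p) / (1 - p)" and T = "{0..1}"])
       (use assms im in \<open>auto intro!: derivative_eq_intros\<close>)
  then have "((\<lambda>x. (1 - p) * f ((x - p) / (1 - p))) has_real_derivative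
      (1 - p) * (a * (1 / (1 - p)))) (at p within {p..1})"
    by (rule DERIV_cmult)
  then have "(lower_right f p has_real_derivative a) (at p within {p..1})"
    using assms(3) by (simp add: lower_right_def[abs_def])
  from tangent_line_interval_eq[OF this] show ?thesis
    using assms by (simp add: lower_right_def)
qed

context
  fixes f :: "real \<Rightarrow> real" and a b p :: real
  assumes f0: "f 0 = 0" and f1: "f 1 = 0"
    and a: "(f has_real_derivative a) (at 0 within {0..1})"
    and b: "(f has_real_derivative b) (at 1 within {0..1})"
    and ab: "b < a"
    and p: "0 < p" "p < 1"
begin

lemma tangent_line_ends:
  "tangent_line f {0..1} 0 = {(x, y). y = 0 + a * (x - 0)}"
  "tangent_line f {0..1} 1 = {(x, y). y = 0 + b * (x - 1)}"
  using tangent_line_interval_eq[OF a] tangent_line_interval_eq[OF b] f0 f1 by simp_all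

text \<open>The abscissa solves \<open>a * x = b * (x - p)\<close>; those of \<open>T2\<close> and
  \<open>T3\<close> come likewise from \<open>a * x = b * (x - 1)\<close> and
  \<open>a * (x - p) = b * (x - 1)\<close>.\<close>

lemma T1_eq: "T1 f p = (- b * p / (a - b), - a * b * p / (a - b))"
proof -
  have "T1 f p = (- b * p / (a - b), 0 + a * (- b * p / (a - b) - 0))"
    unfolding T1_def tangent_line_lower_left[OF b f1 p(1)] tangent_line_ends
    by (rule meet_eq) (use ab in \<open>simp_all add: field_simps\<close>)
  then show ?thesis by simp
qed

lemma T2_eq: "T2 f p = (- b / (a - b), - a * b / (a - b))"
proof -
  have "T2 f p = (- b / (a - b), 0 + a * (- b / (a - b) - 0))"
    unfolding T2_def tangent_line_ends
    by (rule meet_eq) (use ab in \<open>simp_all add: field_simps\<close>)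
  then show ?thesis by simp
qed

lemma T3_eq: "T3 f p = ((a * p - b) / (a - b), - a * b * (1 - p) / (a - b))"
proof -
  have "T3 f p = ((a * p - b) / (a - b), 0 + a * ((a * p - b) / (a - b) - p))"
    unfolding T3_def tangent_line_lower_right[OF a f0 p(2)] tangent_line_ends
    by (rule meet_eq) (use ab in \<open>simp_all add: field_simps\<close>)
  then show ?thesis using ab by (simp add: field_simps)
qed

end

section \<open>Tangency of the diagonal as a linear system\<close>

lemma affine_hull_2_eq_line_iff:
  fixes x1 y1 x2 y2 x0 y0 m :: real
  assumes "x1 \<noteq> x2"
  shows "affine hull {(x1, y1), (x2, y2)} = {(x, y). y = y0 + m * (x - x0)} \<longleftrightarrow>
    y1 = y0 + m * (x1 - x0) \<and> y2 = y0 + m * (x2 - x0)" (is "?H = ?L \<longleftrightarrow> ?R")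
proof
  assume "?H = ?L"
  moreover have "(x1, y1) \<in> ?H" "(x2, y2) \<in> ?H" by (simp_all add: hull_inc)
  ultimately show ?R by simp
next
  assume R: ?R
  show "?H = ?L"
  proof (intro set_eqI iffI)
    fix q assume "q \<in> ?H"
    then obtain u v where "q = (u * x1 + v * x2, u * y1 + v * y2)" and "u + v = 1"
      unfolding affine_hull_2 by auto
    moreover have "u * y1 + v * y2 = (u + v) * y0 + m * (u * x1 + v * x2 - (u + v) * x0)"
      by (simp only: R[THEN conjunct1] R[THEN conjunct2]) (simp add: algebra_simps)
    ultimately show "q \<in> ?L" by simp
  next
    fix q assume "q \<in> ?L"
    then obtain x where q: "q = (x, y0 + m * (x - x0))" by auto
    \<comment> \<open>The weight of the second point is read off from the abscissas; affinity of the
      line then gives the right ordinate.\<close>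
    define v where "v = (x - x1) / (x2 - x1)"
    have v: "v * (x2 - x1) = x - x1" using assms by (simp add: v_def)
    have x: "(1 - v) * x1 + v * x2 = x" using v by (simp add: algebra_simps)
    have "(1 - v) * y1 + v * y2 = y0 + m * ((1 - v) * x1 + v * x2 - x0)"
      by (simp only: R[THEN conjunct1] R[THEN conjunct2]) (simp add: algebra_simps)
    with x have "q = (1 - v) *\<^sub>R (x1, y1) + v *\<^sub>R (x2, y2)" by (simp add: q)
    then show "q \<in> ?H" unfolding affine_hull_2 by force
  qed
qed

text \<open>Here \<open>y\<close> and \<open>m\<close> stand for \<open>f p\<close> and
  \<open>f'(p)\<close>. That both vertices lie on the line gives two linear equations in
  \<open>y\<close> and \<open>m\<close>. Their solution needs \<open>D \<noteq> 0\<close>, which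
  holds because \<open>D\<close> is a convex combination of the positive numbers \<open>a\<close>
  and \<open>- b\<close>.\<close>

lemma diagonal_tangent_iff:
  fixes a b p y m :: real
  assumes "b < 0" "0 < a" "0 < p" "p < 1"
  defines "D \<equiv> (a + b) * p - b"
  shows "affine hull {(- b * p / (a - b), - a * b * p / (a - b)),
      ((a * p - b) / (a - b), - a * b * (1 - p) / (a - b))} = {(s, t). t = y + m * (s - p)} \<longleftrightarrow>
    y = - a * b * p * (1 - p) / D \<and> m = - a * b * (1 - 2 * p) / D"
proof -
  have "D = a * p + (- b) * (1 - p)" by (simp add: D_def algebra_simps)
  moreover have "0 < a * p" "0 < (- b) * (1 - p)" using assms by (simp_all add: mult_neg_pos)
  ultimately have D: "0 < D" by linarith
  have e: "0 < a - b" using assms by simp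
  \<comment> \<open>The two sides differ by exactly \<open>D\<close>, so the diagonal is not
    vertical.\<close>
  have "- b * p \<noteq> a * p - b"
    using D by (auto simp: D_def algebra_simps)
  then have ne: "- b * p / (a - b) \<noteq> (a * p - b) / (a - b)"
    using e by (simp only: divide_cancel_right) simp
  have "y + m * (- b * p / (a - b) - p) = (y * (a - b) - m * a * p) / (a - b)"
    using e by (simp add: field_simps)
  then have "- a * b * p / (a - b) = y + m * (- b * p / (a - b) - p) \<longleftrightarrow>
      - a * b * p = y * (a - b) - m * a * p" (is "?P1 \<longleftrightarrow> ?Q1")
    using e by (simp only: divide_cancel_right) simp
  moreover have "y + m * ((a * p - b) / (a - b) - p) = (y * (a - b) - m * b * (1 - p)) / (a - b)"
    using e by (simp add: field_simps)
  then have "- a * b * (1 - p) / (a - b) = y + m * ((a * p - b) / (a - b) - p) \<longleftrightarrow>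
      - a * b * (1 - p) = y * (a - b) - m * b * (1 - p)" (is "?P2 \<longleftrightarrow> ?Q2")
    using e by (simp only: divide_cancel_right) simp
  moreover have "?Q1 \<and> ?Q2 \<longleftrightarrow>
      y * D = - a * b * p * (1 - p) \<and> m * D = - a * b * (1 - 2 * p)" (is "_ \<longleftrightarrow> ?R1 \<and> ?R2")
  proof
    assume *: "?Q1 \<and> ?Q2"
    \<comment> \<open>Subtracting the two equations eliminates \<open>y\<close>.\<close>
    have R2: ?R2 using * unfolding D_def by (simp add: algebra_simps)
    \<comment> \<open>Multiplying \<open>?Q1\<close> by \<open>D\<close> lets \<open>m * D\<close>
      be substituted without division; the common factor \<open>a - b\<close> then cancels.\<close>
    have "(a - b) * (y * D) = D * (y * (a - b) - m * a * p) + m * D * (a * p)"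
      by (simp add: algebra_simps)
    also have "\<dots> = D * (- a * b * p) + m * D * (a * p)"
      using * by simp
    also have "\<dots> = (a - b) * (- a * b * p * (1 - p))"
      unfolding R2 by (simp add: D_def algebra_simps)
    finally have ?R1 using e by (subst (asm) mult_cancel_left) auto
    with R2 show "?R1 \<and> ?R2" by blast
  next
    assume *: "?R1 \<and> ?R2"
    have "D * (y * (a - b) - m * a * p) = (y * D) * (a - b) - (m * D) * a * p"
      by (simp add: algebra_simps)
    also have "\<dots> = D * (- a * b * p)"
      by (simp only: *[THEN conjunct1] *[THEN conjunct2]) (simp add: D_def algebra_simps)
    finally have 1: ?Q1 using D by (subst (asm) mult_cancel_left) auto
    have "D * (y * (a - b) - m * b * (1 - p)) = (y * D) * (a - b) - (m * D) * b * (1 - p)"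
      by (simp add: algebra_simps)
    also have "\<dots> = D * (- a * b * (1 - p))"
      by (simp only: *[THEN conjunct1] *[THEN conjunct2]) (simp add: D_def algebra_simps)
    finally have ?Q2 using D by (subst (asm) mult_cancel_left) auto
    with 1 show "?Q1 \<and> ?Q2" by blast
  qed
  moreover have "?R1 \<and> ?R2 \<longleftrightarrow> y = - a * b * p * (1 - p) / D \<and> m = - a * b * (1 - 2 * p) / D"
    using D by (simp add: field_simps)
  ultimately show ?thesis
    unfolding affine_hull_2_eq_line_iff[OF ne] by blast
qed

section \<open>From the two formulas to the parabola\<close>

lemma opposite_end_slopes:
  fixes f :: "real \<Rightarrow> real" and a b :: real
  assumes ab: "b < 0" "0 < a"
    and f: "\<And>p. 0 < p \<Longrightarrow> p < 1 \<Longrightarrow> f p = - a * b * p * (1 - p) / ((a + b) * p - b)"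
    and f': "\<And>p. 0 < p \<Longrightarrow> p < 1 \<Longrightarrow>
      (f has_real_derivative - a * b * (1 - 2 * p) / ((a + b) * p - b)) (at p)"
  shows "b = - a"
proof -
  define D where "D = (a + b) * (1/2) - b"
  have D: "0 < D" using ab by (simp add: D_def)
  \<comment> \<open>One point suffices. At 1/2 the numerator has derivative 0, so the quotient rule
    leaves only the term with \<open>a + b\<close>, whereas the prescribed slope there is 0.\<close>
  have "((\<lambda>p. - a * b * p * (1 - p) / ((a + b) * p - b)) has_real_derivative
      - ((a + b) * (- a * b * (1/4))) / D\<^sup>2) (at (1/2))"
    using D unfolding D_def
    by (auto intro!: derivative_eq_intros simp: power2_eq_square field_simps)
  then have "(f has_real_derivative - ((a + b) * (- a * b * (1/4))) / D\<^sup>2) (at (1/2))"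
    by (rule has_field_derivative_transform_within_open[of _ _ _ "{0<..<1}"]) (auto simp: f)
  from DERIV_unique[OF this f'[of "1/2"]] have "(a + b) * (a * b) = 0"
    using D by simp
  then show ?thesis using ab by auto
qed

lemma parabola_derivative:
  assumes "\<forall>x\<in>{0..1}. f x = k * (x - x\<^sup>2)" "p \<in> {0..1}"
  shows "(f has_real_derivative k * (1 - 2 * p)) (at p within {0..1})"
proof (rule has_field_derivative_transform_within[OF _ zero_less_one assms(2)])
  show "((\<lambda>x. k * (x - x\<^sup>2)) has_real_derivative k * (1 - 2 * p)) (at p within {0..1})"
    by (auto intro!: derivative_eq_intros)
qed (use assms in auto)

lemma parallelogram_rectangle_iff:
  fixes k p :: real
  assumes "0 < k" "0 < p" "p < 1"
  shows "is_rectangle (p / 2, k * p / 2) (1/2, k / 2) ((p + 1) / 2, k * (1 - p) / 2) (p, 0)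
    \<longleftrightarrow> k = 1"
proof -
  have "\<not> collinear {(p / 2, k * p / 2), (1/2, k / 2), ((p + 1) / 2, k * (1 - p) / 2)}"
  proof
    assume "collinear {(p / 2, k * p / 2), (1/2, k / 2), ((p + 1) / 2, k * (1 - p) / 2)}"
    then obtain u :: "real \<times> real" and c d where
      "(1/2, k / 2) - (p / 2, k * p / 2) = c *\<^sub>R u"
      "((p + 1) / 2, k * (1 - p) / 2) - (1/2, k / 2) = d *\<^sub>R u"
      unfolding collinear_def by (metis insertI1 insertI2)
    then have *: "(1 - p) / 2 = c * fst u" "k * (1 - p) / 2 = c * snd u"
      "p / 2 = d * fst u" "- k * p / 2 = d * snd u"
      by (auto simp: prod_eq_iff algebra_simps diff_divide_distrib add_divide_distrib)
    \<comment> \<open>Parallel vectors have zero cross product; here this would make a positive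
      number equal to its negative.\<close>
    have "(1 - p) / 2 * (- k * p / 2) = k * (1 - p) / 2 * (p / 2)"
      unfolding * by simp
    then show False using assms by simp
  qed
  moreover have "orthogonal ((1/2, k / 2) - (p / 2, k * p / 2)) ((p, 0) - (p / 2, k * p / 2))
    \<longleftrightarrow> k = 1"
  proof -
    \<comment> \<open>The adjacent sides have slopes \<open>k\<close> and \<open>- k\<close>;
      positivity of \<open>k\<close> excludes the root \<open>k = - 1\<close>.\<close>
    have "((1/2, k / 2) - (p / 2, k * p / 2)) \<bullet> ((p, 0) - (p / 2, k * p / 2))
        = p * (1 - p) / 4 * ((1 - k) * (1 + k))"
      by (simp add: field_simps)
    then show ?thesis using assms by (auto simp: orthogonal_def)
  qed
  ultimately show ?thesis
    by (auto simp: is_rectangle_def is_parallelogram_def field_simps)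
qed

theorem mainTheorem2:
  fixes f :: "real \<Rightarrow> real"
  assumes belos: "\<forall>p\<in>{0<..<1}. determines_belos f p"
    and diff0: "f differentiable (at 0 within {0..1})"
    and diff1: "f differentiable (at 1 within {0..1})"
  shows "((\<forall>p\<in>{0<..<1}. affine hull {T1 f p, T3 f p} = tangent_line f {0..1} p)
            \<longleftrightarrow> (\<exists>k::real. \<forall>x\<in>{0..1}. f x = k * (x - x^2)))
       \<and> (\<forall>k::real. (\<forall>x\<in>{0..1}. f x = k * (x - x^2)) \<longrightarrow>
            (\<forall>p\<in>{0<..<1}. is_rectangle (T1 f p) (T2 f p) (T3 f p) (p, 0) \<longleftrightarrow> k = 1))"
proof -
  obtain a b where a: "(f has_real_derivative a) (at 0 within {0..1})"
    and b: "(f has_real_derivative b) (at 1 within {0..1})"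
    using diff0 diff1 by (auto simp: real_differentiable_def)
  have apos: "0 < a" and bneg: "b < 0"
    using belos_slope_0_pos[OF belos a] belos_slope_1_neg[OF belos b] by auto
  then have ab: "b < a" by simp
  have f0: "f 0 = 0" and f1: "f 1 = 0" and diff: "f differentiable_on {0<..<1}"
    using belos[rule_format, of "1/2"] by (auto simp: determines_belos_def)
  note T1 = T1_eq[OF f0 f1 a b ab] and T2 = T2_eq[OF f0 f1 a b ab] and T3 = T3_eq[OF f0 f1 a b ab]
  have tangent: "affine hull {T1 f p, T3 f p} = tangent_line f {0..1} p \<longleftrightarrow>
      f p = - a * b * p * (1 - p) / ((a + b) * p - b) \<and>
      m = - a * b * (1 - 2 * p) / ((a + b) * p - b)"
    if "0 < p" "p < 1" "(f has_real_derivative m) (at p within {0..1})" for p m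
    using that diagonal_tangent_iff[OF bneg apos that(1,2)]
    by (simp add: T1 T3 tangent_line_interval_eq[OF that(3)])
  \<comment> \<open>Both derivatives at an end point describe the same tangent line, so comparing
    the two line equations at one point identifies the slopes.\<close>
  have slopes: "a = k \<and> b = - k" if k: "\<forall>x\<in>{0..1}. f x = k * (x - x\<^sup>2)" for k
  proof -
    have "(f has_real_derivative k) (at 0 within {0..1})"
      "(f has_real_derivative - k) (at 1 within {0..1})"
      using parabola_derivative[OF k, of 0] parabola_derivative[OF k, of 1] by simp_all
    note tangent_line_interval_eq[OF this(1)] tangent_line_interval_eq[OF this(2)]
      tangent_line_interval_eq[OF a] tangent_line_interval_eq[OF b]
    then have "{(x, y). y = k * x} = {(x, y). y = a * x}"
      "{(x, y). y = - k * (x - 1)} = {(x, y). y = b * (x - 1)}"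
      using f0 f1 by simp_all
    then have "(1, a) \<in> {(x, y). y = k * x}" "(0, - b) \<in> {(x, y). y = - k * (x - 1)}"
      by (simp_all only: mem_Collect_eq case_prod_conv) simp_all
    then show ?thesis by simp
  qed
  show ?thesis
  proof (rule conjI, rule iffI; (intro allI impI ballI)?)
    assume L: "\<forall>p\<in>{0<..<1}. affine hull {T1 f p, T3 f p} = tangent_line f {0..1} p"
    have *: "f p = - a * b * p * (1 - p) / ((a + b) * p - b) \<and>
        (f has_real_derivative - a * b * (1 - 2 * p) / ((a + b) * p - b)) (at p)"
      if p: "0 < p" "p < 1" for p
    proof -
      have "f differentiable (at p)"
        using diff p
        by (metis at_within_open differentiable_on_def greaterThanLessThan_iff open_greaterThanLessThan)
      then obtain m where m: "(f has_real_derivative m) (at p)"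
        by (auto simp: real_differentiable_def)
      with L p tangent[OF p DERIV_subset[OF m subset_UNIV]] show ?thesis by simp
    qed
    have "b = - a"
      using opposite_end_slopes[OF bneg apos *[THEN conjunct1] *[THEN conjunct2]] .
    \<comment> \<open>With \<open>b = - a\<close> the denominator is the constant
      \<open>a\<close>.\<close>
    then have "a * f x = a * (a * (x - x\<^sup>2))" if "0 < x" "x < 1" for x
      using *[OF that, THEN conjunct1] apos by (simp add: field_simps power2_eq_square)
    then have "f x = a * (x - x\<^sup>2)" if "0 < x" "x < 1" for x
      using that apos by (metis mult_left_cancel less_irrefl)
    then have "\<forall>x\<in>{0..1}. f x = a * (x - x\<^sup>2)"
      using f0 f1 by (metis atLeastAtMost_iff cancel_comm_monoid_add_class.diff_cancel
          less_eq_real_def mult_zero_right one_power2 zero_power2)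
    then show "\<exists>k. \<forall>x\<in>{0..1}. f x = k * (x - x\<^sup>2)" by blast
  next
    fix p :: real
    assume "\<exists>k. \<forall>x\<in>{0..1}. f x = k * (x - x\<^sup>2)" and p: "p \<in> {0<..<1}"
    then obtain k where k: "\<forall>x\<in>{0..1}. f x = k * (x - x\<^sup>2)" by blast
    have "(f has_real_derivative k * (1 - 2 * p)) (at p within {0..1})"
      using parabola_derivative[OF k] p by simp
    from tangent[OF _ _ this]
    show "affine hull {T1 f p, T3 f p} = tangent_line f {0..1} p"
      using p slopes[OF k] k apos by (simp add: field_simps power2_eq_square)
  next
    fix k p :: real
    assume k: "\<forall>x\<in>{0..1}. f x = k * (x - x\<^sup>2)" and p: "p \<in> {0<..<1}"
    \<comment> \<open>Since \<open>a\<close> is positive, so is \<open>k\<close>, as the rectangle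
      criterion requires.\<close>
    have ak: "a = k" "b = - k" using slopes[OF k] by auto
    have "T1 f p = (p / 2, k * p / 2)" "T2 f p = (1/2, k / 2)"
      "T3 f p = ((p + 1) / 2, k * (1 - p) / 2)"
      using p apos by (simp_all add: T1 T2 T3 ak field_simps)
    then show "is_rectangle (T1 f p) (T2 f p) (T3 f p) (p, 0) \<longleftrightarrow> k = 1"
      using parallelogram_rectangle_iff[of k p] p apos ak by simp
  qed
qed

end
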